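(* For every integer $n \ge 0$, $$\det\left(H_{i+j}(2)\right)_{i,j=0}^{2n} = 0$$ and $$\det\left(H_{i+j}(2)\right)_{i,j=0}^{2n+1} = \frac{(-1)^{n+1}\, 2^{4n^2+7n+3}\, n!}{(2n+1)!\,(2n+1)!!\,\prod_{j=1}^{2n+1}\binom{2j}{j}\binom{2j-1}{j}}.$$
   Context: For integers $m \ge 0$, $H_m(2) = \sum_{k=1}^{m} \frac{2^k}{k}$ (so $H_0(2)=0$). The notation $(a_{i,j})_{i,j=0}^{N}$ denotes the $(N+1)\times(N+1)$ matrix with indices $0\le i,j\le N$. The double factorial is $(2n+1)!! = 1\cdot 3\cdot 5\cdots(2n+1)$. *)

theory Defs
  imports Complex_Main "Jordan_Normal_Form.Determinant"
begin

definition gen_harmonic :: "real \<Rightarrow> nat \<Rightarrow> real" where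
  "gen_harmonic x m = (\<Sum>k = 1..m. x ^ k / real k)"

fun double_fact :: "nat \<Rightarrow> nat" where
  "double_fact 0 = 1"
| "double_fact (Suc 0) = 1"
| "double_fact (Suc (Suc n)) = Suc (Suc n) * double_fact n"

text \<open>The index bound \<open>N\<close> is inclusive: the matrix \<open>(a (i + j))\<close> with \<open>0 \<le> i, j \<le> N\<close>
  has size \<open>N + 1\<close>.\<close>
definition hankel_mat :: "(nat \<Rightarrow> 'a) \<Rightarrow> nat \<Rightarrow> 'a mat" where
  "hankel_mat a N = mat (N + 1) (N + 1) (\<lambda>(i, j). a (i + j))"

end

theory Submission
  imports Defs
begin

text \<open>Formally \<open>H\<^sub>m(2)\<close> is the integral of \<open>((1 + u)^m - 1) / u\<close> over \<open>[-1, 1]\<close>, so the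
  translation by \<open>1\<close>, which leaves Hankel determinants unchanged, replaces \<open>H\<^sub>m(2)\<close> by the
  principal value integral of \<open>u^(m - 1)\<close>: this is \<open>2 / m\<close> for odd \<open>m\<close> and \<open>0\<close> for even \<open>m\<close>.
  A Hankel matrix of such a sequence has a checkerboard pattern. In odd size its determinant
  vanishes by parity; in even size, listing the even indices first leaves two identical
  off-diagonal blocks with entries \<open>2 / (2 i + 2 j + 1)\<close>, a Cauchy matrix.\<close>

section \<open>Binomial transforms and Hankel determinants\<close>

text \<open>Umbrally this is \<open>(1 + u)^m\<close> under the linear functional sending
  \<open>u^k\<close> to \<open>a k\<close>, so translation by \<open>1\<close> acts on moments in
  this way.\<close>

definition binomial_transform :: "(nat \<Rightarrow> 'a::comm_ring_1) \<Rightarrow> nat \<Rightarrow> 'a" where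
  "binomial_transform a m = (\<Sum>k\<le>m. of_nat (m choose k) * a k)"

lemma binomial_transform_0 [simp]: "binomial_transform a 0 = a 0"
  by (simp add: binomial_transform_def)

text \<open>Umbral form of \<open>(1 + u)^(m + 1) = (1 + u)^m + u * (1 + u)^m\<close>;
  multiplication by \<open>u\<close> shifts the sequence.\<close>

lemma binomial_transform_Suc:
  "binomial_transform a (Suc m) = binomial_transform a m + binomial_transform (\<lambda>k. a (Suc k)) m"
proof -
  have "binomial_transform a (Suc m)
      = a 0 + (\<Sum>k\<le>m. of_nat (m choose Suc k) * a (Suc k))
        + (\<Sum>k\<le>m. of_nat (m choose k) * a (Suc k))"
    by (simp add: binomial_transform_def sum.atMost_Suc_shift algebra_simps sum.distrib
        del: sum.atMost_Suc)
  also have "a 0 + (\<Sum>k\<le>m. of_nat (m choose Suc k) * a (Suc k))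
      = (\<Sum>k\<le>Suc m. of_nat (m choose k) * a k)"
    by (subst sum.atMost_Suc_shift) (simp add: binomial_eq_0)
  also have "\<dots> = binomial_transform a m"
    by (simp add: binomial_transform_def binomial_eq_0)
  finally show ?thesis
    by (simp add: binomial_transform_def)
qed

text \<open>Umbral form of \<open>(1 + u)^(i + j) = (1 + u)^i * (1 + u)^j\<close>. The induction
  needs \<open>a\<close> arbitrary because each step also uses the shifted sequence.\<close>

lemma binomial_transform_add:
  "binomial_transform a (i + j) = binomial_transform (\<lambda>p. binomial_transform (\<lambda>q. a (p + q)) j) i"
proof (induction i arbitrary: a)
  case (Suc i)
  show ?case
    by (simp add: binomial_transform_Suc Suc)
qed simp

lemma binomial_transform_extend:
  assumes "m \<le> N"
  shows "binomial_transform a m = (\<Sum>k\<le>N. of_nat (m choose k) * a k)"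
  unfolding binomial_transform_def
  by (rule sum.mono_neutral_left) (use assms in \<open>auto simp: binomial_eq_0\<close>)

text \<open>The new matrix is \<open>B * H * B^T\<close>, where \<open>B\<close> is the Pascal
  matrix, lower triangular with unit diagonal.\<close>

lemma det_hankel_binomial_transform:
  "det (hankel_mat (binomial_transform a) N) = det (hankel_mat a N)"
proof -
  define B :: "'a mat" where "B = mat (N + 1) (N + 1) (\<lambda>(i, j). of_nat (i choose j))"
  define H where "H = hankel_mat a N"
  have B: "B \<in> carrier_mat (N + 1) (N + 1)" and H: "H \<in> carrier_mat (N + 1) (N + 1)"
    by (simp_all add: B_def H_def hankel_mat_def)
  have "hankel_mat (binomial_transform a) N = B * (H * transpose_mat B)"
  proof (rule eq_matI)
    fix i j assume "i < dim_row (B * (H * transpose_mat B))" "j < dim_col (B * (H * transpose_mat B))"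
    hence ij: "i \<le> N" "j \<le> N" using B by auto
    have "(B * (H * transpose_mat B)) $$ (i, j)
        = (\<Sum>p = 0..<Suc N. of_nat (i choose p) *
            (\<Sum>q = 0..<Suc N. a (p + q) * of_nat (j choose q)))"
      using ij by (simp add: B_def H_def hankel_mat_def scalar_prod_def del: sum.op_ivl_Suc)
    also have "\<dots> = binomial_transform a (i + j)"
      using ij by (simp add: binomial_transform_add binomial_transform_extend[of _ N]
          atLeast0LessThan lessThan_Suc_atMost mult.commute del: sum.op_ivl_Suc)
    finally show "hankel_mat (binomial_transform a) N $$ (i, j) = (B * (H * transpose_mat B)) $$ (i, j)"
      using ij by (simp add: hankel_mat_def)
  qed (use B in \<open>auto simp: hankel_mat_def\<close>)
  moreover have "det B = 1"
    by (subst det_lower_triangular[OF _ B])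
      (auto simp: B_def prod_list_diag_prod binomial_eq_0 intro!: prod.neutral)
  ultimately show ?thesis
    using B H by (simp add: det_mult[of _ "N + 1"] det_transpose[of _ "N + 1"] H_def[symmetric])
qed

section \<open>Hankel determinants of sequences vanishing at even indices\<close>

text \<open>A nonzero Leibniz term would make all \<open>2 * n + 1\<close> numbers
  \<open>i + p i\<close> odd, hence their sum odd, but that sum is twice the sum of the indices.
  Unlike a sign argument giving \<open>2 * det = 0\<close>, this works in any
  characteristic.\<close>

lemma det_hankel_even_support:
  fixes a :: "nat \<Rightarrow> 'a::comm_ring_1"
  assumes "\<And>k. even k \<Longrightarrow> a k = 0"
  shows "det (hankel_mat a (2 * n)) = 0"
proof -
  have "(\<Prod>i = 0..<2 * n + 1. hankel_mat a (2 * n) $$ (i, p i)) = 0"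
    if p: "p permutes {0..<2 * n + 1}" for p
  proof (rule ccontr)
    assume nz: "(\<Prod>i = 0..<2 * n + 1. hankel_mat a (2 * n) $$ (i, p i)) \<noteq> 0"
    have "odd (i + p i)" if "i \<in> {0..<2 * n + 1}" for i
    proof (rule ccontr)
      assume e: "\<not> odd (i + p i)"
      have "p i \<in> {0..<2 * n + 1}"
        using permutes_in_image[OF p] that by blast
      with e that assms[of "i + p i"] have "hankel_mat a (2 * n) $$ (i, p i) = 0"
        by (simp add: hankel_mat_def)
      with that nz show False
        by (metis (no_types, lifting) finite_atLeastLessThan prod_zero)
    qed
    hence "odd (\<Sum>i = 0..<2 * n + 1. i + p i)"
      by (subst even_sum_iff) (simp_all add: Collect_conv_if Int_absorb1 subset_iff cong: conj_cong)
    moreover have "(\<Sum>i = 0..<2 * n + 1. i + p i) = 2 * (\<Sum>i = 0..<2 * n + 1. i)"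
      using sum.permute[OF p, of "\<lambda>i. i"] by (simp add: sum.distrib o_def del: sum.op_ivl_Suc)
    ultimately show False by (metis dvd_triv_left)
  qed
  thus ?thesis
    by (subst det_def'[of _ "2 * n + 1"]) (auto simp: hankel_mat_def intro!: sum.neutral)
qed

text \<open>The sign of \<open>p\<close> enters once for rows and once for columns, and squares to
  \<open>1\<close>. Columns are treated as rows of the transpose.\<close>

lemma det_permute_rows_cols:
  assumes A: "A \<in> carrier_mat n n" and p: "p permutes {0..<n}"
  shows "det (mat n n (\<lambda>(i, j). A $$ (p i, p j))) = det A"
proof -
  define R where "R = mat n n (\<lambda>(i, j). A $$ (p i, j))"
  have R: "R \<in> carrier_mat n n" by (simp add: R_def)
  have lt: "p i < n" if "i < n" for i
    using permutes_in_image[OF p, of i] that by simp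
  have "mat n n (\<lambda>(i, j). A $$ (p i, p j))
      = transpose_mat (mat n n (\<lambda>(i, j). transpose_mat R $$ (p i, j)))"
    by (rule eq_matI) (auto simp: R_def lt)
  hence "det (mat n n (\<lambda>(i, j). A $$ (p i, p j))) = signof p * det (transpose_mat R)"
    using det_permute_rows[OF _ p, of "transpose_mat R"] R
    by (simp add: det_transpose[of _ n])
  also have "\<dots> = signof p * (signof p * det A)"
    using det_permute_rows[OF A p] R by (simp add: det_transpose[of _ n] R_def)
  also have "\<dots> = det A"
    by (simp add: sign_def)
  finally show ?thesis .
qed

text \<open>The last branch is the identity because \<open>permutes\<close> requires fixed points
  outside \<open>{0..<2 * m}\<close>.\<close>

definition evens_first :: "nat \<Rightarrow> nat \<Rightarrow> nat" where
  "evens_first m i = (if i < m then 2 * i else if i < 2 * m then 2 * (i - m) + 1 else i)"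

lemma evens_first_permutes: "evens_first m permutes {0..<2 * m}"
proof (rule bij_imp_permutes)
  have "inj_on (evens_first m) {0..<2 * m}"
    unfolding inj_on_def evens_first_def by (auto split: if_splits; presburger)
  moreover have "evens_first m ` {0..<2 * m} \<subseteq> {0..<2 * m}"
    by (auto simp: evens_first_def)
  ultimately show "bij_betw (evens_first m) {0..<2 * m} {0..<2 * m}"
    by (simp add: bij_betw_def endo_inj_surj)
qed (auto simp: evens_first_def)

lemma det_hankel_odd_support:
  fixes a :: "nat \<Rightarrow> 'a::idom"
  assumes "\<And>k. even k \<Longrightarrow> a k = 0"
  shows "det (hankel_mat a (2 * n + 1))
    = (-1) ^ (n + 1) * (det (mat (n + 1) (n + 1) (\<lambda>(i, j). a (2 * i + 2 * j + 1))))\<^sup>2"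
proof -
  define m where "m = n + 1"
  define A where "A = mat m m (\<lambda>(i, j). a (2 * i + 2 * j + 1))"
  have A: "A \<in> carrier_mat m m" by (simp add: A_def)
  define H where "H = hankel_mat a (2 * n + 1)"
  have H: "H \<in> carrier_mat (2 * m) (2 * m)"
    by (simp add: H_def hankel_mat_def m_def)
  have entry: "H $$ (i, j) = a (i + j)" if "i < 2 * m" "j < 2 * m" for i j
    using that by (simp add: H_def hankel_mat_def m_def)
  have "mat (2 * m) (2 * m) (\<lambda>(i, j). H $$ (evens_first m i, evens_first m j))
      = four_block_mat (0\<^sub>m m m) A A (0\<^sub>m m m)"
    by (rule eq_matI) (auto simp: A_def entry evens_first_def assms)
  hence "det H = det (four_block_mat (0\<^sub>m m m) A A (0\<^sub>m m m))"
    using det_permute_rows_cols[OF H evens_first_permutes] by simp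
  \<comment> \<open>The block determinant formula needs commuting blocks; a zero block commutes with
    \<open>A\<close>.\<close>
  also have "\<dots> = det (0\<^sub>m m m * 0\<^sub>m m m - A * A)"
    by (rule det_four_block_mat) (use A in auto)
  also have "0\<^sub>m m m * 0\<^sub>m m m - A * A = (-1) \<cdot>\<^sub>m (A * A)"
    by (rule eq_matI) (use A in auto)
  also have "det \<dots> = (-1) ^ m * (det A)\<^sup>2"
    using A by (simp add: det_mult power2_eq_square)
  finally show ?thesis
    by (simp add: A_def m_def H_def)
qed

section \<open>Cauchy determinants by Schur complements\<close>

text \<open>Block elimination with the last diagonal entry as pivot: \<open>L\<close> is unit upper
  triangular, and \<open>T\<close> is block lower triangular with the Schur complement
  \<open>S\<close> in its corner. Pivoting on the last entry leaves the other indices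
  unchanged.\<close>

lemma det_schur_last:
  fixes f :: "nat \<Rightarrow> nat \<Rightarrow> 'a::field"
  assumes nz: "f n n \<noteq> 0"
  shows "det (mat (Suc n) (Suc n) (\<lambda>(i, j). f i j))
    = f n n * det (mat n n (\<lambda>(i, j). f i j - f i n * f n j / f n n))"
proof -
  define L where "L = four_block_mat (1\<^sub>m n) (mat n 1 (\<lambda>(i, j). f i n / f n n)) (0\<^sub>m 1 n) (1\<^sub>m 1)"
  define S where "S = mat n n (\<lambda>(i, j). f i j - f i n * f n j / f n n)"
  define T where "T = four_block_mat S (0\<^sub>m n 1) (mat 1 n (\<lambda>(i, j). f n j)) (mat 1 1 (\<lambda>_. f n n))"
  have carr: "L \<in> carrier_mat (Suc n) (Suc n)" "T \<in> carrier_mat (Suc n) (Suc n)"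
    by (auto simp: L_def T_def S_def intro!: carrier_matI)
  have "mat (Suc n) (Suc n) (\<lambda>(i, j). f i j) = L * T"
    unfolding L_def T_def
    by (subst mult_four_block_mat[of _ n n _ 1 _ 1 _ _ n _ 1])
      (auto simp: S_def scalar_prod_def nz less_Suc_eq intro!: eq_matI)
  moreover have "det L = 1"
    unfolding L_def by (subst det_four_block_mat_lower_left_zero[of _ n _ 1]) auto
  moreover have "det T = det S * f n n"
    unfolding T_def by (subst det_four_block_mat_upper_right_zero[of _ n _ 1]) (auto simp: S_def det_single)
  ultimately show ?thesis
    using carr by (simp add: det_mult S_def mult.commute)
qed

text \<open>Every Leibniz term gains the same factor, since a permutation only reorders the product
  of the \<open>s j\<close>.\<close>

lemma det_scale_rows_cols:
  fixes f :: "nat \<Rightarrow> nat \<Rightarrow> 'a::comm_ring_1"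
  shows "det (mat n n (\<lambda>(i, j). r i * s j * f i j))
    = (\<Prod>i<n. r i) * (\<Prod>j<n. s j) * det (mat n n (\<lambda>(i, j). f i j))"
proof -
  have eq: "(\<Prod>i = 0..<n. mat n n (\<lambda>(i, j). r i * s j * f i j) $$ (i, p i))
      = (\<Prod>i<n. r i) * (\<Prod>j<n. s j) * (\<Prod>i = 0..<n. mat n n (\<lambda>(i, j). f i j) $$ (i, p i))"
    if p: "p permutes {0..<n}" for p
  proof -
    have "p i < n" if "i < n" for i
      using permutes_in_image[OF p, of i] that by simp
    hence "(\<Prod>i = 0..<n. mat n n (\<lambda>(i, j). r i * s j * f i j) $$ (i, p i))
        = (\<Prod>i = 0..<n. r i * s (p i) * mat n n (\<lambda>(i, j). f i j) $$ (i, p i))"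
      by (intro prod.cong) auto
    also have "\<dots> = (\<Prod>i = 0..<n. r i) * (\<Prod>i = 0..<n. s (p i))
        * (\<Prod>i = 0..<n. mat n n (\<lambda>(i, j). f i j) $$ (i, p i))"
      by (simp add: prod.distrib)
    also have "(\<Prod>i = 0..<n. s (p i)) = (\<Prod>i = 0..<n. s i)"
      using prod.permute[OF p, of s] by (simp add: o_def)
    finally show ?thesis by (simp add: atLeast0LessThan)
  qed
  show ?thesis
    unfolding det_def'[OF mat_carrier] sum_distrib_left
    by (intro sum.cong refl, subst eq) (simp, simp only: mult_ac)
qed

text \<open>The Schur complement of a Cauchy matrix is again Cauchy up to row and column
  factors.\<close>

lemma det_cauchy_Suc:
  fixes x y :: "nat \<Rightarrow> 'a::field"
  assumes nz: "\<And>i j. i \<le> n \<Longrightarrow> j \<le> n \<Longrightarrow> x i + y j \<noteq> 0"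
  shows "det (mat (Suc n) (Suc n) (\<lambda>(i, j). 1 / (x i + y j)))
    = 1 / (x n + y n) * (\<Prod>i<n. (x i - x n) / (x i + y n)) * (\<Prod>j<n. (y j - y n) / (x n + y j))
      * det (mat n n (\<lambda>(i, j). 1 / (x i + y j)))"
proof -
  \<comment> \<open>Over a common denominator the numerator
    \<open>(x i + y n) * (x n + y j) - (x n + y n) * (x i + y j)\<close> factors as
    \<open>(x i - x n) * (y j - y n)\<close>.\<close>
  have eq: "1 / (x i + y j) - 1 / (x i + y n) * (1 / (x n + y j)) / (1 / (x n + y n))
      = (x i - x n) / (x i + y n) * ((y j - y n) / (x n + y j)) * (1 / (x i + y j))"
    if "i < n" "j < n" for i j
    using that nz[of i j] nz[of i n] nz[of n j] nz[of n n]
    by (simp add: divide_simps) (simp add: algebra_simps)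
  have "det (mat (Suc n) (Suc n) (\<lambda>(i, j). 1 / (x i + y j)))
      = 1 / (x n + y n) * det (mat n n (\<lambda>(i, j). 1 / (x i + y j)
          - 1 / (x i + y n) * (1 / (x n + y j)) / (1 / (x n + y n))))"
    by (rule det_schur_last) (use nz[of n n] in simp)
  also have "mat n n (\<lambda>(i, j). 1 / (x i + y j)
          - 1 / (x i + y n) * (1 / (x n + y j)) / (1 / (x n + y n)))
      = mat n n (\<lambda>(i, j). (x i - x n) / (x i + y n) * ((y j - y n) / (x n + y j)) * (1 / (x i + y j)))"
    by (rule eq_matI) (simp_all add: eq del: times_divide_eq_right times_divide_eq_left divide_divide_eq_right)
  also have "det \<dots> = (\<Prod>i<n. (x i - x n) / (x i + y n)) * (\<Prod>j<n. (y j - y n) / (x n + y j))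
      * det (mat n n (\<lambda>(i, j). 1 / (x i + y j)))"
    by (rule det_scale_rows_cols)
  finally show ?thesis by (simp only: mult.assoc)
qed

section \<open>Evaluation of the Cauchy determinant with entries
  \<open>2 / (2 i + 2 j + 1)\<close>\<close>

text \<open>The product is the Gamma quotient of \<open>n + m + 1/2\<close> by
  \<open>n + 1/2\<close>, written without division. Separating \<open>m\<close> from
  \<open>n\<close> permits induction; the application takes \<open>m = n\<close>.\<close>

lemma prod_shifted_half:
  "(\<Prod>i<m. real i + real n + 1 / 2) * (4 ^ m * fact (n + m) * fact (2 * n)) = fact (2 * n + 2 * m) * fact n"
proof (induction m)
  case (Suc m)
  have "(\<Prod>i<Suc m. real i + real n + 1 / 2) * (4 ^ Suc m * fact (n + Suc m) * fact (2 * n))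
      = ((\<Prod>i<m. real i + real n + 1 / 2) * (4 ^ m * fact (n + m) * fact (2 * n)))
        * (4 * (real m + real n + 1 / 2) * (real n + real m + 1))"
    by (simp add: algebra_simps)
  also have "\<dots> = fact (2 * n + 2 * Suc m) * fact n"
    unfolding Suc by (simp add: algebra_simps)
  finally show ?case .
qed simp

lemma prod_diff_fact: "(\<Prod>i<n. real i - real n) = (-1) ^ n * fact n"
proof -
  have "(\<Prod>i<n. real i - real n) = (\<Prod>i<n. - 1 * real (n - i))"
    by (intro prod.cong) auto
  also have "\<dots> = (-1) ^ n * fact n"
    by (simp only: prod.distrib) (simp add: fact_prod_rev atLeast0LessThan)
  finally show ?thesis .
qed

lemma prod_ratio_central_binomial:
  "(\<Prod>i<n. (real i - real n) / (real i + real n + 1 / 2))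
    = (-1) ^ n * 4 ^ n / real ((4 * n) choose (2 * n))"
proof -
  have "(\<Prod>i<n. real i + real n + 1 / 2)
      = fact (4 * n) * fact n / (4 ^ n * fact (2 * n) * fact (2 * n))"
    using prod_shifted_half[where n = n and m = n] by (simp add: field_simps mult_2[symmetric])
  thus ?thesis
    unfolding prod_dividef prod_diff_fact by (simp add: binomial_fact)
qed

text \<open>The nodes are \<open>x i = i\<close> and \<open>y j = j + 1/2\<close>. They differ by a
  constant, so the row and column products coincide and their signs cancel.\<close>

lemma det_cauchy_half_Suc:
  "det (mat (Suc n) (Suc n) (\<lambda>(i, j). 2 / real (2 * i + 2 * j + 1)))
    = 2 * 16 ^ n / (real (4 * n + 1) * (real ((4 * n) choose (2 * n)))\<^sup>2)
      * det (mat n n (\<lambda>(i, j). 2 / real (2 * i + 2 * j + 1)))"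
proof -
  define y where "y j = real j + 1 / 2" for j :: nat
  have entry: "(\<lambda>(i, j). 2 / real (2 * i + 2 * j + 1)) = (\<lambda>(i, j). 1 / (real i + y j))"
    by (auto simp: fun_eq_iff y_def field_simps)
  have "(\<Prod>j<n. (y j - y n) / (real n + y j)) = (\<Prod>i<n. (real i - real n) / (real i + y n))"
    by (intro prod.cong) (auto simp: y_def algebra_simps)
  also have "\<dots> = (-1) ^ n * 4 ^ n / real ((4 * n) choose (2 * n))"
    using prod_ratio_central_binomial[of n] by (simp add: y_def add_ac)
  finally have P: "(\<Prod>j<n. (y j - y n) / (real n + y j)) = (-1) ^ n * 4 ^ n / real ((4 * n) choose (2 * n))"
    "(\<Prod>i<n. (real i - real n) / (real i + y n)) = (-1) ^ n * 4 ^ n / real ((4 * n) choose (2 * n))"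
    using prod_ratio_central_binomial[of n] by (simp_all add: y_def add_ac)
  have sq: "((-1) ^ n * 4 ^ n / c) * ((-1) ^ n * 4 ^ n / c) = 16 ^ n / c\<^sup>2" for c :: real
    by (simp add: power2_eq_square power_mult_distrib[symmetric])
  have half: "1 / (real n + y n) = 2 / real (4 * n + 1)"
    by (simp add: y_def field_simps)
  show ?thesis
    unfolding entry
    by (subst det_cauchy_Suc)
      (simp_all only: P half sq mult.assoc, auto simp: y_def add_eq_0_iff field_simps)
qed

lemma central_binomial_Suc:
  "real ((2 * Suc k) choose Suc k) = 2 * real (2 * k + 1) / real (k + 1) * real ((2 * k) choose k)"
  by (simp add: binomial_fact divide_simps del: binomial_Suc_Suc) (simp add: algebra_simps)

text \<open>At \<open>j = 0\<close> truncated subtraction would give \<open>1\<close> on the left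
  and \<open>1 / 2\<close> on the right.\<close>

lemma binomial_odd_middle:
  assumes "j \<ge> 1"
  shows "real ((2 * j - 1) choose j) = real ((2 * j) choose j) / 2"
proof -
  obtain k where "j = Suc k" using assms by (cases j) auto
  moreover have "real ((2 * k + 1) choose (k + 1)) = real ((2 * k + 2) choose (k + 1)) / 2"
    by (simp add: binomial_fact divide_simps del: binomial_Suc_Suc)
  ultimately show ?thesis by simp
qed

text \<open>By induction: the ratio of consecutive closed forms is matched with the square of the
  factor in \<open>det_cauchy_half_Suc\<close>.\<close>

lemma det_cauchy_half_square:
  "(det (mat (n + 1) (n + 1) (\<lambda>(i, j). 2 / real (2 * i + 2 * j + 1))))\<^sup>2
    = 2 ^ (4 * n\<^sup>2 + 7 * n + 3) * fact n
        / (fact (2 * n + 1) * real (double_fact (2 * n + 1))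
           * (\<Prod>j = 1..2 * n + 1. real ((2 * j) choose j) * real ((2 * j - 1) choose j)))"
proof (induction n)
  case 0
  show ?case by (simp add: det_single)
next
  case (Suc n)
  define D where "D = det (mat (n + 1) (n + 1) (\<lambda>(i, j). 2 / real (2 * i + 2 * j + 1)))"
  \<comment> \<open>This is the central binomial coefficient in the recurrence at
    \<open>n + 1\<close>. The four binomials entering the product, for \<open>j = 2 * n + 2\<close>
    and \<open>j = 2 * n + 3\<close>, are all rational multiples of it.\<close>
  define c where "c = real ((4 * n + 4) choose (2 * n + 2))"
  define Q where "Q = (\<Prod>j = 1..2 * n + 1. real ((2 * j) choose j) * real ((2 * j - 1) choose j))"
  have c: "c > 0" by (simp add: c_def)
  have Q: "Q > 0" unfolding Q_def by (intro prod_pos) auto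
  have df: "double_fact k > 0" for k by (induction k rule: double_fact.induct) auto
  have "2 * (2 * n + 2) = 4 * n + 4" by simp
  hence c1: "real ((2 * (2 * n + 2)) choose (2 * n + 2)) = c"
    by (simp only: c_def)
  have c1': "real ((2 * (2 * n + 2) - 1) choose (2 * n + 2)) = c / 2"
    by (subst binomial_odd_middle) (simp, simp only: c1)
  have Suc_3: "Suc (2 * n + 2) = 2 * n + 3" by simp
  have c2: "real ((2 * (2 * n + 3)) choose (2 * n + 3)) = 2 * real (4 * n + 5) / real (2 * n + 3) * c"
    using central_binomial_Suc[of "2 * n + 2"] unfolding c1 Suc_3 by (simp add: algebra_simps)
  have half: "2 * u / v * w / 2 = u / v * w" for u v w :: real by simp
  have c3: "real ((2 * (2 * n + 3) - 1) choose (2 * n + 3)) = real (4 * n + 5) / real (2 * n + 3) * c"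
    by (subst binomial_odd_middle) (simp, simp only: c2 half)
  have collect: "(2 * u / v * c) * (u / v * c) * (c * (c / 2) * Q) = u\<^sup>2 * c ^ 4 * Q / v\<^sup>2"
    for u v :: real
    by (simp add: power2_eq_square power4_eq_xxxx)
  have "{1..2 * Suc n + 1} = insert (2 * n + 3) (insert (2 * n + 2) {1..2 * n + 1})"
    by auto
  hence "(\<Prod>j = 1..2 * Suc n + 1. real ((2 * j) choose j) * real ((2 * j - 1) choose j))
      = (2 * real (4 * n + 5) / real (2 * n + 3) * c) * (real (4 * n + 5) / real (2 * n + 3) * c)
        * (c * (c / 2) * Q)"
    by (simp only: Q_def)
      (subst prod.insert, simp, simp, subst prod.insert, simp, simp,
        simp only: c1 c1' c2 c3 mult.assoc)
  hence Q': "(\<Prod>j = 1..2 * Suc n + 1. real ((2 * j) choose j) * real ((2 * j - 1) choose j))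
      = (real (4 * n + 5))\<^sup>2 * c ^ 4 * Q / (real (2 * n + 3))\<^sup>2"
    by (simp only: collect)
  \<comment> \<open>The two factors \<open>2 * n + 3\<close> cancel the square in \<open>Q'\<close>;
    \<open>n + 1\<close> cancels between the factorials, and the remaining \<open>2\<close> absorbs
    the spare \<open>2\<close> in \<open>pow\<close>.\<close>
  have f: "fact (2 * Suc n + 1) = real (2 * n + 3) * (2 * real (n + 1)) * fact (2 * n + 1)"
    "fact (Suc n) = real (n + 1) * fact n"
    "real (double_fact (2 * Suc n + 1)) = real (2 * n + 3) * real (double_fact (2 * n + 1))"
    by (simp_all add: algebra_simps del: power_Suc)
  have e: "4 * (Suc n)\<^sup>2 + 7 * Suc n + 3 = (4 * n\<^sup>2 + 7 * n + 3) + (8 * n + 11)"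
    by (simp add: power2_eq_square)
  have "(2::real) ^ (8 * n) = (2 ^ 8) ^ n" "((16::real) ^ n)\<^sup>2 = (16\<^sup>2) ^ n"
    by (simp_all only: power_mult[symmetric] mult.commute)
  hence pow: "(2::real) ^ (8 * n + 11) = 2 * (2 * 16 ^ (n + 1))\<^sup>2"
    by (simp add: power_add power_mult_distrib)
  have p: "(2::real) ^ (4 * (Suc n)\<^sup>2 + 7 * Suc n + 3)
      = 2 ^ (4 * n\<^sup>2 + 7 * n + 3) * (2 * (2 * 16 ^ (n + 1))\<^sup>2)"
    unfolding e power_add[of 2 "4 * n\<^sup>2 + 7 * n + 3" "8 * n + 11"]
    by (simp only: pow)
  have "det (mat (Suc n + 1) (Suc n + 1) (\<lambda>(i, j). 2 / real (2 * i + 2 * j + 1)))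
      = 2 * 16 ^ (n + 1) / (real (4 * n + 5) * c\<^sup>2) * D"
    using det_cauchy_half_Suc[of "n + 1"] by (simp add: D_def c_def algebra_simps)
  hence "(det (mat (Suc n + 1) (Suc n + 1) (\<lambda>(i, j). 2 / real (2 * i + 2 * j + 1))))\<^sup>2
      = (2 * 16 ^ (n + 1))\<^sup>2 / ((real (4 * n + 5))\<^sup>2 * c ^ 4) * D\<^sup>2"
    by (simp add: power_mult_distrib power_divide power_mult[symmetric])
  also have "D\<^sup>2 = 2 ^ (4 * n\<^sup>2 + 7 * n + 3) * fact n
        / (fact (2 * n + 1) * real (double_fact (2 * n + 1)) * Q)"
    using Suc by (simp add: D_def Q_def)
  also have "(2 * 16 ^ (n + 1))\<^sup>2 / ((real (4 * n + 5))\<^sup>2 * c ^ 4) * \<dots>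
      = 2 ^ (4 * (Suc n)\<^sup>2 + 7 * Suc n + 3) * fact (Suc n)
        / (fact (2 * Suc n + 1) * real (double_fact (2 * Suc n + 1))
           * ((real (4 * n + 5))\<^sup>2 * c ^ 4 * Q / (real (2 * n + 3))\<^sup>2))"
  proof -
    \<comment> \<open>The powers of two and factorials are kept abstract, since the simplifier would expand them.\<close>
    have gen: "X\<^sup>2 / (A * C) * (E * F / (G * K * Q))
        = E * (2 * X\<^sup>2) * (N * F) / (M * (2 * N) * G * (M * K) * (A * C * Q / M\<^sup>2))"
      if "A > 0" "C > 0" "G > 0" "K > 0" "M > 0" "N > 0" for X A C E F G K M N :: real
      using that Q by (simp add: field_simps power2_eq_square)
    show ?thesis
      unfolding f p
      by (rule gen) (use c df[of "2 * n + 1"] in auto)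
  qed
  finally show ?case by (simp only: Q')
qed

section \<open>The moment sequence behind \<open>H_m(2)\<close>\<close>

text \<open>The value \<open>0\<close> at \<open>k = 0\<close> is the principal value for
  \<open>1 / u\<close>, and agrees with the empty sum \<open>gen_harmonic 2 0\<close>.\<close>

definition odd_moment :: "nat \<Rightarrow> real" where
  "odd_moment k = (if odd k then 2 / real k else 0)"

text \<open>Even \<open>k\<close> means odd lower index \<open>Suc k\<close>, and the odd-index
  binomials make up half of the row sum \<open>2 ^ Suc m\<close>.\<close>

lemma odd_binomial_sum: "(\<Sum>k\<le>m. if even k then real (Suc m choose Suc k) else 0) = 2 ^ m"
proof -
  have "(\<Sum>k\<le>m. if even k then real (Suc m choose Suc k) else 0)
      = (\<Sum>k\<le>Suc m. if odd k then real (Suc m choose k) else 0)"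
    by (subst sum.atMost_Suc_shift) (simp del: binomial_Suc_Suc)
  thus ?thesis
    using choose_odd_sum[of "Suc m", where 'a = real] by (simp del: sum.atMost_Suc binomial_Suc_Suc)
qed

text \<open>Both sides start at \<open>0\<close> and have increment
  \<open>2 ^ (m + 1) / (m + 1)\<close>; for the transform, the increment is the transform of the
  shifted moments.\<close>

lemma gen_harmonic_2_eq_binomial_transform: "gen_harmonic 2 = binomial_transform odd_moment"
proof
  fix m show "gen_harmonic 2 m = binomial_transform odd_moment m"
  proof (induction m)
    case 0
    show ?case by (simp add: gen_harmonic_def odd_moment_def)
  next
    case (Suc m)
    have "real (m choose k) * odd_moment (Suc k)
        = 2 / real (m + 1) * (if even k then real (Suc m choose Suc k) else 0)" for k
    proof -
      \<comment> \<open>Absorption trades the denominator \<open>k + 1\<close> of the moment for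
        \<open>m + 1\<close>, which leaves the sum over \<open>k\<close>.\<close>
      have "real (Suc k) * real (Suc m choose Suc k) = real (Suc m) * real (m choose k)"
        by (metis Suc_times_binomial of_nat_mult)
      thus ?thesis by (auto simp: odd_moment_def divide_simps mult_ac simp del: binomial_Suc_Suc)
    qed
    hence "binomial_transform (\<lambda>k. odd_moment (Suc k)) m = 2 / real (m + 1) * 2 ^ m"
      by (simp only: binomial_transform_def sum_distrib_left[symmetric] odd_binomial_sum)
    with Suc show ?case
      by (simp add: gen_harmonic_def binomial_transform_Suc)
  qed
qed

theorem theorem4p3:
  fixes n :: nat
  shows "det (hankel_mat (gen_harmonic 2) (2 * n)) = 0
    \<and> det (hankel_mat (gen_harmonic 2) (2 * n + 1)) =
        (-1) ^ (n + 1) * 2 ^ (4 * n\<^sup>2 + 7 * n + 3) * fact n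
        / (fact (2 * n + 1) * real (double_fact (2 * n + 1))
           * (\<Prod>j = 1..2 * n + 1. real ((2 * j) choose j) * real ((2 * j - 1) choose j)))"
proof
  have 0: "odd_moment k = 0" if "even k" for k
    using that by (simp add: odd_moment_def)
  show "det (hankel_mat (gen_harmonic 2) (2 * n)) = 0"
    unfolding gen_harmonic_2_eq_binomial_transform det_hankel_binomial_transform
    by (rule det_hankel_even_support) (rule 0)
  have "det (hankel_mat (gen_harmonic 2) (2 * n + 1))
      = (-1) ^ (n + 1) * (det (mat (n + 1) (n + 1) (\<lambda>(i, j). odd_moment (2 * i + 2 * j + 1))))\<^sup>2"
    unfolding gen_harmonic_2_eq_binomial_transform det_hankel_binomial_transform
    by (rule det_hankel_odd_support) (rule 0)
  also have "(\<lambda>(i, j). odd_moment (2 * i + 2 * j + 1)) = (\<lambda>(i, j). 2 / real (2 * i + 2 * j + 1))"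
    by (auto simp: odd_moment_def fun_eq_iff)
  finally show "det (hankel_mat (gen_harmonic 2) (2 * n + 1)) =
        (-1) ^ (n + 1) * 2 ^ (4 * n\<^sup>2 + 7 * n + 3) * fact n
        / (fact (2 * n + 1) * real (double_fact (2 * n + 1))
           * (\<Prod>j = 1..2 * n + 1. real ((2 * j) choose j) * real ((2 * j - 1) choose j)))"
    by (simp only: det_cauchy_half_square times_divide_eq_right mult.assoc)
qed

end
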